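(* Let $X$ be a shift space. If $X$ has the average shadowing property, then $X$ has the $\bar d$-shadowing property.
   Context: $\mathbb{N}_0=\{0,1,2,\ldots\}$, $\mathbb{N}=\{1,2,\ldots\}$. Let $\mathscr{A}=\{0,1\}$ and let $\mathscr{A}^\infty$ be the set of all sequences $x=\{x_n\}_{n=0}^\infty$ over $\mathscr{A}$, with the product topology and the metric $\rho(x,y)=0$ if $x=y$ and $\rho(x,y)=2^{-\min\{n: x_n\ne y_n\}}$ otherwise. The shift map is $\sigma(x)=\{x_{n+1}\}_{n=0}^\infty$. A shift space is a nonempty, closed, $\sigma$-invariant set $X\subseteq\mathscr{A}^\infty$ (meaning $\sigma(X)\subseteq X$), viewed as the topological dynamical system $(X,\sigma)$. Its language $\mathcal{L}(X)$ is the set of finite words $w$ over $\mathscr{A}$ such that some $x\in X$ begins with $w$; $|w|$ denotes the length of $w$. For $x,y\in\mathscr{A}^\infty$ let $\bar d(x,y)=\limsup_{n\to\infty}\frac1n|\{i\in[0,n): x_i\ne y_i\}|$. $\bar d$-shadowing property: for every $\varepsilon>0$ there is $N\in\mathbb{N}$ such that for every sequence $\{w^{(i)}\}_{i=1}^\infty\subset\mathcal{L}(X)$ with $|w^{(i)}|\ge N$ for all $i$ there is $x\in X$ with $\bar d(x,w)<\varepsilon$, where $w=w^{(1)}w^{(2)}\ldots\in\mathscr{A}^\infty$ is the infinite concatenation (which need not belong to $X$). $\delta$-average pseudo-orbit in $X$: a sequence $\underline{x}=\{x^{(n)}\}_{n=0}^\infty$ of points of $X$ for which there is $N\in\mathbb{N}$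 such that for all $n\ge N$ and $k\in\mathbb{N}_0$, $\frac1n\sum_{i=0}^{n-1}\rho(\sigma(x^{(i+k)}),x^{(i+k+1)})<\delta$. Average shadowing property: for every $\varepsilon>0$ there is $\delta>0$ such that for every $\delta$-average pseudo-orbit $\underline{x}$ in $X$ there is $z\in X$ with $\limsup_{n\to\infty}\frac1n\sum_{i=0}^{n-1}\rho(\sigma^i(z),x^{(i)})<\varepsilon$. *)

theory Defs
  imports "HOL-Analysis.Analysis"
begin

text \<open>
  The alphabet \<open>{0,1}\<close> is the type \<^typ>\<open>bool\<close>, which the library equips with the discrete
  topology; a point of the full shift is a function \<^typ>\<open>nat \<Rightarrow> bool\<close>, and \<^const>\<open>closed\<close> on sets of
  such functions refers to the product topology.
\<close>

type_synonym point = "nat \<Rightarrow> bool"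

definition rho :: "point \<Rightarrow> point \<Rightarrow> real" where
  "rho x y = (if x = y then 0 else 1 / 2 ^ (LEAST n. x n \<noteq> y n))"

definition shift_map :: "point \<Rightarrow> point" where
  "shift_map x = (\<lambda>n. x (Suc n))"

definition shift_space :: "point set \<Rightarrow> bool" where
  "shift_space X \<longleftrightarrow> X \<noteq> {} \<and> closed X \<and> shift_map ` X \<subseteq> X"

definition language :: "point set \<Rightarrow> bool list set" where
  "language X = {w. \<exists>x\<in>X. map x [0..<length w] = w}"

text \<open>
  The upper limits are taken in \<^typ>\<open>ereal\<close>. The term for \<open>n = 0\<close> is \<open>0\<close> by the convention
  \<open>1 / 0 = 0\<close> and does not affect them.
\<close>

definition dbar :: "point \<Rightarrow> point \<Rightarrow> ereal" where
  "dbar x y = limsup (\<lambda>n. ereal (1 / real n * real (card {i. i < n \<and> x i \<noteq> y i})))"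

text \<open>
  The infinite concatenation \<open>w 0 @ w 1 @ \<dots>\<close>, meaningful only if all words are nonempty: then
  the first \<open>n + 1\<close> words have total length greater than \<open>n\<close>.
\<close>

definition inf_concat :: "(nat \<Rightarrow> bool list) \<Rightarrow> point" where
  "inf_concat w = (\<lambda>n. concat (map w [0..<Suc n]) ! n)"

lemma inf_concat_prefix:
  assumes "\<And>i. w i \<noteq> []"
  shows "map (inf_concat w) [0..<length (concat (map w [0..<k]))] = concat (map w [0..<k])"
proof -
  define C where "C = (\<lambda>k. concat (map w [0..<k]))"
  have len: "k \<le> length (C k)" for k
  proof (induction k)
    case (Suc k)
    have "0 < length (w k)" using assms by simp
    moreover have "length (C (Suc k)) = length (C k) + length (w k)" by (simp add: C_def)
    ultimately show ?case using Suc by linarith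
  qed (simp add: C_def)
  have ext: "\<exists>v. C l = C k @ v" if "k \<le> l" for k l
    using that by (induction l rule: dec_induct) (auto simp: C_def)
  have "inf_concat w n = C k ! n" if n: "n < length (C k)" for n
  proof -
    have n': "n < length (C (Suc n))" using len[of "Suc n"] by simp
    have "C (Suc n) ! n = C k ! n"
    proof (cases "Suc n \<le> k")
      case True
      then obtain v where "C k = C (Suc n) @ v" using ext by blast
      with n' show ?thesis by (simp add: nth_append)
    next
      case False
      then obtain v where "C (Suc n) = C k @ v" using ext[of k "Suc n"] by auto
      with n show ?thesis by (simp add: nth_append)
    qed
    then show ?thesis by (simp add: inf_concat_def C_def)
  qed
  then have "map (inf_concat w) [0..<length (C k)] = C k"
    by (intro nth_equalityI) auto
  then show ?thesis by (simp add: C_def)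
qed

definition dbar_shadowing :: "point set \<Rightarrow> bool" where
  "dbar_shadowing X \<longleftrightarrow>
     (\<forall>\<epsilon>::real. \<epsilon> > 0 \<longrightarrow> (\<exists>N::nat. N \<ge> 1 \<and>
       (\<forall>w :: nat \<Rightarrow> bool list. (\<forall>i. w i \<in> language X \<and> length (w i) \<ge> N) \<longrightarrow>
         (\<exists>x\<in>X. dbar x (inf_concat w) < ereal \<epsilon>))))"

definition average_pseudo_orbit :: "point set \<Rightarrow> real \<Rightarrow> (nat \<Rightarrow> point) \<Rightarrow> bool" where
  "average_pseudo_orbit X \<delta> xs \<longleftrightarrow>
     (\<forall>n. xs n \<in> X) \<and>
     (\<exists>N::nat. N \<ge> 1 \<and> (\<forall>n k. n \<ge> N \<longrightarrow>
        1 / real n * (\<Sum>i<n. rho (shift_map (xs (i + k))) (xs (i + k + 1))) < \<delta>))"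

definition average_shadowing :: "point set \<Rightarrow> bool" where
  "average_shadowing X \<longleftrightarrow>
     (\<forall>\<epsilon>::real. \<epsilon> > 0 \<longrightarrow> (\<exists>\<delta>::real. \<delta> > 0 \<and>
       (\<forall>xs. average_pseudo_orbit X \<delta> xs \<longrightarrow>
         (\<exists>z\<in>X. limsup (\<lambda>n. ereal (1 / real n * (\<Sum>i<n. rho ((shift_map ^^ i) z) (xs i))))
                 < ereal \<epsilon>))))"

end

theory Submission
  imports Defs
begin

text \<open>
  Choose points \<open>y i \<in> X\<close> starting with \<open>w i\<close> and follow the orbit of \<open>y i\<close> along the \<open>i\<close>-th block
  of the concatenation. The resulting sequence of points makes an error, of size at most \<open>1\<close>, only
  when it passes from one block to the next; in a window of length \<open>n\<close> this happens at most
  \<open>n / N + 1\<close> times, so long words give a pseudo-orbit with small average error. A point tracing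
  it on average has small \<open>dbar\<close>-distance to the concatenation, since \<open>rho\<close> equals \<open>1\<close> on points
  with different initial symbols.
\<close>

lemma rho_le_1: "rho x y \<le> 1"
  by (simp add: rho_def)

lemma rho_nonneg: "0 \<le> rho x y"
  by (simp add: rho_def)

lemma rho_eq_1: "x 0 \<noteq> y 0 \<Longrightarrow> rho x y = 1"
  by (auto simp: rho_def Least_eq_0)

lemma shift_map_funpow: "(shift_map ^^ n) x = (\<lambda>i. x (i + n))"
  by (induction n) (simp_all add: shift_map_def)

lemma shift_space_funpow_mem: "shift_space X \<Longrightarrow> x \<in> X \<Longrightarrow> (shift_map ^^ n) x \<in> X"
  by (induction n) (auto simp: shift_space_def)

definition block_start :: "(nat \<Rightarrow> bool list) \<Rightarrow> nat \<Rightarrow> nat" where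
  "block_start w k = length (concat (map w [0..<k]))"

definition block_index :: "(nat \<Rightarrow> bool list) \<Rightarrow> nat \<Rightarrow> nat" where
  "block_index w n = (LEAST k. n < block_start w (Suc k))"

lemma block_start_0 [simp]: "block_start w 0 = 0"
  and block_start_Suc [simp]: "block_start w (Suc k) = block_start w k + length (w k)"
  by (simp_all add: block_start_def)

text \<open>Used twice: with bound 1, to see that block starts are unbounded, and with the bound
  \<open>N\<close> on the word lengths, to count the blocks that fit into a window.\<close>

lemma block_start_add:
  assumes "\<And>i. N \<le> length (w i)"
  shows "block_start w k + m * N \<le> block_start w (k + m)"
proof (induction m)
  case (Suc m)
  with assms[of "k + m"] show ?case by simp
qed simp

lemma less_block_start_Suc_block_index:
  assumes "\<And>i. w i \<noteq> []"
  shows "n < block_start w (Suc (block_index w n))"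
  unfolding block_index_def
proof (rule LeastI)
  \<comment> \<open>The first \<open>Suc n\<close> nonempty words have total length above
    \<open>n\<close>, so \<open>n\<close> itself is a witness that the \<open>LEAST\<close> ranges
    over a nonempty set.\<close>
  have "1 \<le> length (w i)" for i
    using assms[of i] by (simp add: Suc_le_eq)
  from block_start_add[of 1 w 0 "Suc n", OF this] show "n < block_start w (Suc n)"
    by simp
qed

lemma block_start_block_index_le: "block_start w (block_index w n) \<le> n"
proof (cases "block_index w n")
  case (Suc j)
  \<comment> \<open>Minimality of the index rules out its predecessor \<open>j\<close>.\<close>
  then have "\<not> n < block_start w (Suc j)"
    using not_less_Least[of j "\<lambda>k. n < block_start w (Suc k)"] by (simp add: block_index_def)
  with Suc show ?thesis by simp
qed simp

lemma mono_block_index: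
  assumes "\<And>i. w i \<noteq> []"
  shows "mono (block_index w)"
proof (rule monoI)
  fix m n :: nat
  assume "m \<le> n"
  then have "m < block_start w (Suc (block_index w n))"
    using less_block_start_Suc_block_index[of w n, OF assms] by linarith
  then show "block_index w m \<le> block_index w n"
    unfolding block_index_def[of w m] by (rule Least_le)
qed

text \<open>The blocks strictly between those of \<open>k\<close> and \<open>n + k\<close> lie
  wholly inside the window, so there are at most \<open>n / N\<close> of them; the summand 1
  accounts for the step into the last block.\<close>

lemma block_index_diff_le:
  assumes "\<And>i. N \<le> length (w i)" and "N \<ge> 1"
  shows "real (block_index w (n + k)) - real (block_index w k) \<le> real n / real N + 1"
proof (cases "block_index w k < block_index w (n + k)")
  case True
  define m where "m = block_index w (n + k) - Suc (block_index w k)"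
  have ne: "w i \<noteq> []" for i
    using assms(1)[of i] assms(2) by auto
  have "block_start w (Suc (block_index w k)) + m * N \<le> block_start w (block_index w (n + k))"
    using block_start_add[of N w "Suc (block_index w k)" m, OF assms(1)] True
    by (simp add: m_def del: block_start_Suc)
  moreover note less_block_start_Suc_block_index[of w k, OF ne]
    block_start_block_index_le[of w "n + k"]
  ultimately have "m * N \<le> n" by linarith
  then have "real m * real N \<le> real n"
    by (metis of_nat_le_iff of_nat_mult)
  then have "real m \<le> real n / real N"
    using assms(2) by (simp add: pos_le_divide_eq)
  moreover have "real (block_index w (n + k)) - real (block_index w k) = real m + 1"
    using True by (simp add: m_def)
  ultimately show ?thesis by linarith
next
  case False
  then have "real (block_index w (n + k)) - real (block_index w k) \<le> 0" by simp
  also have "0 \<le> real n / real N + 1" by simp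
  finally show ?thesis .
qed

lemma inf_concat_block:
  assumes "\<And>i. w i \<noteq> []"
  shows "inf_concat w n = w (block_index w n) ! (n - block_start w (block_index w n))"
proof -
  let ?j = "block_index w n"
  have lt: "n < block_start w (Suc ?j)"
    by (rule less_block_start_Suc_block_index[OF assms])
  have "map (inf_concat w) [0..<block_start w (Suc ?j)] ! n = concat (map w [0..<Suc ?j]) ! n"
    using inf_concat_prefix[of w "Suc ?j", OF assms] by (simp only: block_start_def)
  moreover have "map (inf_concat w) [0..<block_start w (Suc ?j)] ! n = inf_concat w n"
    using lt by (simp del: block_start_Suc)
  moreover have "concat (map w [0..<Suc ?j]) ! n = w ?j ! (n - block_start w ?j)"
    using block_start_block_index_le[of w n] by (simp add: nth_append block_start_def)
  ultimately show ?thesis by simp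
qed

text \<open>The comparison is termwise: a mismatch of \<open>z\<close> and \<open>v\<close> at
  \<open>i\<close> is a difference of initial symbols after \<open>i\<close> shifts, which costs a
  full 1 in \<open>rho\<close>.\<close>

lemma dbar_le_average_rho:
  assumes "\<And>i. xs i 0 = v i"
  shows "dbar z v \<le> limsup (\<lambda>n. ereal (1 / real n * (\<Sum>i<n. rho ((shift_map ^^ i) z) (xs i))))"
  unfolding dbar_def
proof (intro Limsup_mono always_eventually allI)
  fix n :: nat
  have "real (card {i. i < n \<and> z i \<noteq> v i}) = (\<Sum>i<n. if z i \<noteq> v i then 1 else 0)"
    by (simp add: sum.If_cases Int_def)
  also have "\<dots> \<le> (\<Sum>i<n. rho ((shift_map ^^ i) z) (xs i))"
    by (intro sum_mono) (auto simp: assms shift_map_funpow rho_nonneg rho_eq_1)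
  finally show "ereal (1 / real n * real (card {i. i < n \<and> z i \<noteq> v i}))
      \<le> ereal (1 / real n * (\<Sum>i<n. rho ((shift_map ^^ i) z) (xs i)))"
    by (simp add: divide_right_mono)
qed

definition block_orbit :: "(nat \<Rightarrow> bool list) \<Rightarrow> (nat \<Rightarrow> point) \<Rightarrow> nat \<Rightarrow> point" where
  "block_orbit w y n = (shift_map ^^ (n - block_start w (block_index w n))) (y (block_index w n))"

text \<open>Inside a block the sequence is a true orbit and both sides vanish; at a boundary the
  index grows by at least 1, which dominates \<open>rho\<close>. Bounding by an increment makes sums
  over windows telescope.\<close>

lemma rho_block_orbit_le:
  assumes "\<And>i. w i \<noteq> []"
  shows "rho (shift_map (block_orbit w y n)) (block_orbit w y (Suc n))
    \<le> real (block_index w (Suc n)) - real (block_index w n)"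
proof (cases "block_index w (Suc n) = block_index w n")
  case True
  \<comment> \<open>Since the block starts no later than \<open>n\<close>, the truncated subtraction
    giving the offset really increases by 1.\<close>
  then have "shift_map (block_orbit w y n) = block_orbit w y (Suc n)"
    using block_start_block_index_le[of w n] by (simp add: block_orbit_def Suc_diff_le)
  with True show ?thesis by (simp add: rho_def)
next
  case False
  then have "Suc (block_index w n) \<le> block_index w (Suc n)"
    using monoD[OF mono_block_index[of w, OF assms], of n "Suc n"] by simp
  with rho_le_1[of "shift_map (block_orbit w y n)" "block_orbit w y (Suc n)"] show ?thesis
    by linarith
qed

lemma average_pseudo_orbit_block_orbit:
  assumes "shift_space X" and "\<And>i. y i \<in> X"
    and len: "\<And>i. N \<le> length (w i)" and N: "N \<ge> 1" "2 / real N < \<delta>"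
  shows "average_pseudo_orbit X \<delta> (block_orbit w y)"
  unfolding average_pseudo_orbit_def
proof (intro conjI allI exI[of _ N] impI)
  fix n
  show "block_orbit w y n \<in> X"
    unfolding block_orbit_def using assms(1,2) by (rule shift_space_funpow_mem)
next
  fix n k :: nat
  assume n: "N \<le> n"
  have ne: "w i \<noteq> []" for i
    using len[of i] N(1) by auto
  have "(\<Sum>i<n. rho (shift_map (block_orbit w y (i + k))) (block_orbit w y (i + k + 1)))
      \<le> (\<Sum>i<n. real (block_index w (Suc i + k)) - real (block_index w (i + k)))"
    using rho_block_orbit_le[of w y, OF ne] by (intro sum_mono) simp
  also have "\<dots> = real (block_index w (n + k)) - real (block_index w k)"
    by (subst sum_lessThan_telescope) simp
  also have "\<dots> \<le> real n / real N + 1"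
    by (rule block_index_diff_le[OF len N(1)])
  \<comment> \<open>As \<open>N \<le> n\<close>, the extra 1 is at most \<open>n / N\<close>; hence
    the factor 2 in the condition on \<open>N\<close>.\<close>
  also have "\<dots> \<le> real n * (2 / real N)"
    using n N(1) by (simp add: field_simps)
  also have "\<dots> < real n * \<delta>"
    using n N by (intro mult_strict_left_mono) auto
  finally show "1 / real n *
      (\<Sum>i<n. rho (shift_map (block_orbit w y (i + k))) (block_orbit w y (i + k + 1))) < \<delta>"
    using n N(1) by (simp add: field_simps)
qed (rule N(1))

lemma block_orbit_initial:
  assumes "\<And>i. w i \<noteq> []" and "\<And>i. map (y i) [0..<length (w i)] = w i"
  shows "block_orbit w y n 0 = inf_concat w n"
proof -
  let ?j = "block_index w n"
  let ?r = "n - block_start w ?j"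
  have "?r < length (w ?j)"
    using less_block_start_Suc_block_index[of w n, OF assms(1)] block_start_block_index_le[of w n]
    by simp
  \<comment> \<open>The offset \<open>?r\<close> lies within the word, where \<open>y ?j\<close> is
    known to agree with it.\<close>
  then have "w ?j ! ?r = y ?j ?r"
    by (subst assms(2)[symmetric]) simp
  then show ?thesis
    by (simp add: block_orbit_def shift_map_funpow inf_concat_block[of w, OF assms(1)])
qed

theorem theorem5p14:
  fixes X :: "(nat \<Rightarrow> bool) set"
  assumes "shift_space X"
    and "average_shadowing X"
  shows "dbar_shadowing X"
  unfolding dbar_shadowing_def
proof (intro allI impI)
  fix \<epsilon> :: real
  assume "\<epsilon> > 0"
  then obtain \<delta> where \<delta>: "\<delta> > 0" and shadow: "\<And>xs. average_pseudo_orbit X \<delta> xs \<Longrightarrow>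
      \<exists>z\<in>X. limsup (\<lambda>n. ereal (1 / real n * (\<Sum>i<n. rho ((shift_map ^^ i) z) (xs i)))) < ereal \<epsilon>"
    using assms(2) unfolding average_shadowing_def by meson
  \<comment> \<open>This threshold depends only on \<open>\<delta>\<close>, hence only on
    \<open>\<epsilon>\<close>, so one \<open>N\<close> serves all sequences of words.\<close>
  obtain N :: nat where "2 / \<delta> < real N"
    using reals_Archimedean2 by blast
  moreover from this have "0 < real N"
    using \<delta> by (meson divide_pos_pos less_trans zero_less_numeral)
  ultimately have N: "N \<ge> 1" "2 / real N < \<delta>"
    using \<delta> by (simp_all add: field_simps)
  show "\<exists>N\<ge>1. \<forall>w. (\<forall>i. w i \<in> language X \<and> N \<le> length (w i)) \<longrightarrow>
      (\<exists>x\<in>X. dbar x (inf_concat w) < ereal \<epsilon>)"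
  proof (intro exI[of _ N] conjI allI impI)
    fix w :: "nat \<Rightarrow> bool list"
    assume w: "\<forall>i. w i \<in> language X \<and> N \<le> length (w i)"
    then have len: "N \<le> length (w i)" for i by blast
    have ne: "w i \<noteq> []" for i
      using len[of i] N(1) by auto
    have "\<forall>i. \<exists>x. x \<in> X \<and> map x [0..<length (w i)] = w i"
      using w by (auto simp: language_def)
    then obtain y where y: "\<And>i. y i \<in> X" "\<And>i. map (y i) [0..<length (w i)] = w i"
      by metis
    obtain z where "z \<in> X" and z: "limsup (\<lambda>n. ereal (1 / real n *
        (\<Sum>i<n. rho ((shift_map ^^ i) z) (block_orbit w y i)))) < ereal \<epsilon>"
      using shadow[OF average_pseudo_orbit_block_orbit[of X y N w, OF assms(1) y(1) len N]] by blast
    have "dbar z (inf_concat w) < ereal \<epsilon>"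
      using dbar_le_average_rho[of "block_orbit w y", OF block_orbit_initial[of w y, OF ne y(2)]] z
      by (rule order.strict_trans1)
    with \<open>z \<in> X\<close> show "\<exists>x\<in>X. dbar x (inf_concat w) < ereal \<epsilon>" by blast
  qed (rule N(1))
qed

end
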